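(* Let $G$ be a group of homeomorphisms of a compact Hausdorff space $\mathcal{X}$. Suppose that the action of $G$ on $\mathcal{X}$ is minimal and that for every open set $U\subseteq\mathcal{X}$, the action of $\mathrm{Rist}_G(U)$ on $U$ is locally minimal. Let $x,y\in\mathcal{X}$ be two points. If the groups of germs $\mathrm{St}_G(x)/\mathrm{St}_G^0(x)$ and $\mathrm{St}_G(y)/\mathrm{St}_G^0(y)$ of $x$ and $y$ are not isomorphic, then the stabilisers $\mathrm{St}_G(x)$ and $\mathrm{St}_G(y)$ are not isomorphic. In particular, if $x$ is regular and $y$ is singular, then $\mathrm{St}_G(x)$ and $\mathrm{St}_G(y)$ are not isomorphic.
   Context: "Neighbourhood" always means open neighbourhood. Let $G$ be a group of homeomorphisms of a topological space $\mathcal{X}$. - $\mathrm{St}_G(x)=\{g\in G\mid g(x)=x\}$. The neighbourhood stabiliser $\mathrm{St}_G^0(x)$ is the subgroup of all $g\in \mathrm{St}_G(x)$ whose set of fixed points contains a neighbourhood of $x$; it is a normal subgroup of $\mathrm{St}_G(x)$. A point $x\in\mathcal{X}$ is regular if $\mathrm{St}_G^0(x)=\mathrm{St}_G(x)$, and singular otherwise. - For an open set $U\subseteq\mathcal{X}$, the rigid stabiliser is $\mathrm{Rist}_G(U)=\{g\in G\mid g(x)=x \text{ for all } x\in\mathcal{X}\setminus U\}$. - An action of a group on a space is minimal if the orbit of every point is dense. The action of a group $H$ on a space $Y$ is locally minimal if for every $x\in Y$ there exists a neighbourhood $W\subseteq Y$ of $x$ such that for every $y\in W$, the intersection of the $H$-orbit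 of $y$ with $W$ is dense in $W$. *)

theory Defs
  imports "HOL-Analysis.Analysis" "HOL-Algebra.Group_Action"
begin

text \<open>
  The space is the carrier of a type of class topological_space. A group of homeomorphisms of it
  is a subgroup G of \<open>homeo_group\<close>, and any subgroup H is turned into a group by
  \<open>homeos H\<close>. It acts by evaluation, i.e. the action map in the sense of
  HOL-Algebra is \<open>\<lambda>g. g\<close>.
\<close>

definition homeo_group :: "('a::topological_space \<Rightarrow> 'a) monoid" where
  "homeo_group =
     \<lparr>carrier = {f. homeomorphic_map euclidean euclidean f}, mult = (\<circ>), one = id\<rparr>"

abbreviation homeos :: "('a::topological_space \<Rightarrow> 'a) set \<Rightarrow> ('a \<Rightarrow> 'a) monoid" where
  "homeos H \<equiv> homeo_group\<lparr>carrier := H\<rparr>"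

definition St :: "('a::topological_space \<Rightarrow> 'a) set \<Rightarrow> 'a \<Rightarrow> ('a \<Rightarrow> 'a) set" where
  "St G x = stabilizer (homeos G) (\<lambda>g. g) x"

definition St0 :: "('a::topological_space \<Rightarrow> 'a) set \<Rightarrow> 'a \<Rightarrow> ('a \<Rightarrow> 'a) set" where
  "St0 G x = {g \<in> St G x. \<exists>W. open W \<and> x \<in> W \<and> W \<subseteq> {z. g z = z}}"

definition germ_group :: "('a::topological_space \<Rightarrow> 'a) set \<Rightarrow> 'a \<Rightarrow> ('a \<Rightarrow> 'a) set monoid" where
  "germ_group G x = homeos (St G x) Mod St0 G x"

definition regular_point :: "('a::topological_space \<Rightarrow> 'a) set \<Rightarrow> 'a \<Rightarrow> bool" where
  "regular_point G x \<longleftrightarrow> St0 G x = St G x"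

definition singular_point :: "('a::topological_space \<Rightarrow> 'a) set \<Rightarrow> 'a \<Rightarrow> bool" where
  "singular_point G x \<longleftrightarrow> \<not> regular_point G x"

definition Rist :: "('a::topological_space \<Rightarrow> 'a) set \<Rightarrow> 'a set \<Rightarrow> ('a \<Rightarrow> 'a) set" where
  "Rist G U = {g \<in> G. \<forall>z. z \<notin> U \<longrightarrow> g z = z}"

definition minimal_action :: "('g, 'm) monoid_scheme \<Rightarrow> ('g \<Rightarrow> 'a \<Rightarrow> 'a) \<Rightarrow> 'a topology \<Rightarrow> bool" where
  "minimal_action H \<phi> Y \<longleftrightarrow>
     (\<forall>x \<in> topspace Y. Y closure_of (orbit H \<phi> x) = topspace Y)"

definition locally_minimal_action ::
    "('g, 'm) monoid_scheme \<Rightarrow> ('g \<Rightarrow> 'a \<Rightarrow> 'a) \<Rightarrow> 'a topology \<Rightarrow> bool" where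
  "locally_minimal_action H \<phi> Y \<longleftrightarrow>
     (\<forall>x \<in> topspace Y. \<exists>W. openin Y W \<and> x \<in> W \<and>
        (\<forall>y \<in> W. subtopology Y W closure_of (orbit H \<phi> y \<inter> W) = W))"

lemma carrier_homeo_group:
  "f \<in> carrier homeo_group \<longleftrightarrow> homeomorphic_map euclidean euclidean f"
  by (simp add: homeo_group_def)

lemma mult_homeo_group [simp]: "f \<otimes>\<^bsub>homeo_group\<^esub> g = f \<circ> g"
  by (simp add: homeo_group_def)

lemma one_homeo_group [simp]: "\<one>\<^bsub>homeo_group\<^esub> = id"
  by (simp add: homeo_group_def)

lemma group_homeo_group: "group (homeo_group :: ('a::topological_space \<Rightarrow> 'a) monoid)"
proof (rule groupI)
  fix f :: "'a \<Rightarrow> 'a" assume "f \<in> carrier homeo_group"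
  then obtain g where g: "homeomorphic_maps euclidean euclidean f g"
    by (auto simp: carrier_homeo_group homeomorphic_map_maps)
  then have "g \<circ> f = id"
    by (auto simp: homeomorphic_maps_def)
  moreover have "g \<in> carrier homeo_group"
    using g homeomorphic_maps_sym carrier_homeo_group homeomorphic_map_maps by blast
  ultimately show "\<exists>g \<in> carrier homeo_group. g \<otimes>\<^bsub>homeo_group\<^esub> f = \<one>\<^bsub>homeo_group\<^esub>"
    by auto
qed (auto simp: carrier_homeo_group comp_assoc intro: homeomorphic_map_compose
        homeomorphic_map_id[THEN iffD2])

lemma mem_St: "g \<in> St G x \<longleftrightarrow> g \<in> G \<and> g x = x"
  by (simp add: St_def stabilizer_def)

lemma inv_homeo_group:
  assumes "g \<in> carrier homeo_group"
  shows "(inv\<^bsub>homeo_group\<^esub> g) (g z) = z" "g ((inv\<^bsub>homeo_group\<^esub> g) z) = z"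
  using group.l_inv[OF group_homeo_group assms] group.r_inv[OF group_homeo_group assms]
  by (simp_all add: fun_eq_iff)

lemma subgroup_St:
  assumes G: "subgroup G homeo_group"
  shows "subgroup (St G x) homeo_group"
proof (rule group.subgroupI[OF group_homeo_group])
  show "St G x \<subseteq> carrier homeo_group"
    using subgroup.subset[OF G] by (auto simp: mem_St)
  show "St G x \<noteq> {}"
    using subgroup.one_closed[OF G] mem_St[of id G x] by auto
next
  fix g assume "g \<in> St G x"
  then have g: "g \<in> G" "g x = x" by (auto simp: mem_St)
  then show "inv\<^bsub>homeo_group\<^esub> g \<in> St G x"
    using inv_homeo_group(1)[of g x] subgroup.subset[OF G] subgroup.m_inv_closed[OF G]
    by (auto simp: mem_St)
next
  fix g h assume "g \<in> St G x" "h \<in> St G x"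
  then show "g \<otimes>\<^bsub>homeo_group\<^esub> h \<in> St G x"
    using subgroup.m_closed[OF G, of g h] by (auto simp: mem_St)
qed

lemma subgroup_St0:
  assumes G: "subgroup G homeo_group"
  shows "subgroup (St0 G x) homeo_group"
proof (rule group.subgroupI[OF group_homeo_group])
  note S = subgroup_St[OF G, of x]
  show "St0 G x \<subseteq> carrier homeo_group"
    using subgroup.subset[OF S] by (auto simp: St0_def)
  show "St0 G x \<noteq> {}"
  proof -
    have "id \<in> St0 G x"
      using subgroup.one_closed[OF S] by (auto simp: St0_def)
    then show ?thesis by blast
  qed
next
  note S = subgroup_St[OF G, of x]
  fix g assume "g \<in> St0 G x"
  then obtain W where g: "g \<in> St G x" and W: "open W" "x \<in> W" "\<forall>z\<in>W. g z = z"
    by (auto simp: St0_def)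
  have "\<forall>z\<in>W. (inv\<^bsub>homeo_group\<^esub> g) z = z"
    using W(3) inv_homeo_group(1)[of g] g subgroup.subset[OF S] by (metis subsetD)
  then show "inv\<^bsub>homeo_group\<^esub> g \<in> St0 G x"
    using W subgroup.m_inv_closed[OF S g] by (auto simp: St0_def)
next
  note S = subgroup_St[OF G, of x]
  fix g h assume "g \<in> St0 G x" "h \<in> St0 G x"
  then obtain V W where "g \<in> St G x" "open V" "x \<in> V" "\<forall>z\<in>V. g z = z"
    and "h \<in> St G x" "open W" "x \<in> W" "\<forall>z\<in>W. h z = z"
    by (auto simp: St0_def)
  then show "g \<otimes>\<^bsub>homeo_group\<^esub> h \<in> St0 G x"
    using subgroup.m_closed[OF S, of g h]
    by (auto simp: St0_def intro!: exI[of _ "V \<inter> W"])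
qed

lemma normal_St0:
  assumes G: "subgroup G homeo_group"
  shows "St0 G x \<lhd> homeos (St G x)"
proof -
  note S = subgroup_St[OF G, of x]
  interpret grp: group "homeos (St G x)"
    using group.subgroup_imp_group[OF group_homeo_group S] .
  have "subgroup (St0 G x) (homeos (St G x))"
    using group.subgroup_incl[OF group_homeo_group subgroup_St0[OF G] S]
    by (auto simp: St0_def)
  moreover have "g \<circ> h \<circ> inv\<^bsub>homeo_group\<^esub> g \<in> St0 G x" if g: "g \<in> St G x" and "h \<in> St0 G x" for g h
  proof -
    let ?i = "inv\<^bsub>homeo_group\<^esub> g"
    from that obtain W where h: "h \<in> St G x" and W: "open W" "x \<in> W" "\<forall>z\<in>W. h z = z"
      by (auto simp: St0_def)
    have i: "?i \<in> St G x" using subgroup.m_inv_closed[OF S g] .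
    have gc: "g \<in> carrier homeo_group" using g subgroup.subset[OF S] by blast
    have "continuous_on UNIV ?i"
      using i subgroup.subset[OF S] carrier_homeo_group homeomorphic_imp_continuous_map
      by (metis continuous_map_iff_continuous2 subsetD)
    then have "open (?i -` W)"
      using W(1) by (simp add: open_vimage)
    moreover have "x \<in> ?i -` W" using i W(2) by (simp add: mem_St)
    moreover have "\<forall>z \<in> ?i -` W. (g \<circ> h \<circ> ?i) z = z"
      using W(3) inv_homeo_group(2)[OF gc] by auto
    moreover have "g \<circ> h \<circ> ?i \<in> St G x"
      using subgroup.m_closed[OF S subgroup.m_closed[OF S g h] i] by simp
    ultimately show ?thesis by (auto simp: St0_def)
  qed
  ultimately show ?thesis
    using group.m_inv_consistent[OF group_homeo_group S]
    by (auto simp: grp.normal_inv_iff)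
qed

end

theory Submission
  imports Defs
begin

text \<open>
  An isomorphism of point stabilisers carries germ-trivial elements to germ-trivial elements because
  \<open>St0 G x\<close> can be recognised inside the abstract group \<open>St G x\<close>. Rubin's algebraic
  disjointness is implied by disjointness of supports, and if t is algebraically disjoint from g,
  then the twelfth power of g fixes the support of t. This makes ``the support of k lies in the
  closure of the union of the supports of finitely many elements'' expressible by commutation. Call
  a conjugation invariant subset an ideal if its centraliser is trivial and it is closed
  under this relation. Then \<open>St0 G x\<close> is the least ideal: it is one, and conversely, by
  local minimality, the supports of the elements of any ideal cover the complement of x, so by
  compactness finitely many of them cover the support of a given element of \<open>St0 G x\<close>.
  All this needs a space without isolated points; otherwise minimality makes the space discrete, and
  every germ is trivial.
\<close>

section \<open>An isomorphism invariant of groups\<close>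

definition commutator :: "('g, 'm) monoid_scheme \<Rightarrow> 'g \<Rightarrow> 'g \<Rightarrow> 'g" where
  "commutator K a b = a \<otimes>\<^bsub>K\<^esub> b \<otimes>\<^bsub>K\<^esub> inv\<^bsub>K\<^esub> a \<otimes>\<^bsub>K\<^esub> inv\<^bsub>K\<^esub> b"

text \<open>Asymmetric in its arguments: \<open>f\<close> enters through the elements
  \<open>h\<close> that it fails to commute with, \<open>g\<close> through its centraliser
  alone.\<close>

definition alg_disjoint :: "('g, 'm) monoid_scheme \<Rightarrow> 'g \<Rightarrow> 'g \<Rightarrow> bool" where
  "alg_disjoint K f g \<longleftrightarrow>
     (\<forall>h\<in>carrier K. f \<otimes>\<^bsub>K\<^esub> h \<noteq> h \<otimes>\<^bsub>K\<^esub> f \<longrightarrow>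
        (\<exists>a\<in>carrier K. \<exists>b\<in>carrier K.
           a \<otimes>\<^bsub>K\<^esub> g = g \<otimes>\<^bsub>K\<^esub> a \<and> b \<otimes>\<^bsub>K\<^esub> g = g \<otimes>\<^bsub>K\<^esub> b \<and>
           commutator K a (commutator K b h) \<noteq> \<one>\<^bsub>K\<^esub> \<and>
           commutator K a (commutator K b h) \<otimes>\<^bsub>K\<^esub> g = g \<otimes>\<^bsub>K\<^esub> commutator K a (commutator K b h)))"

text \<open>The exponent 12 is the least common multiple of 1, 2, 3, 4, the possible lengths of the g-orbits
  in the support of t.\<close>

definition dominated :: "('g, 'm) monoid_scheme \<Rightarrow> 'g \<Rightarrow> 'g set \<Rightarrow> bool" where
  "dominated K k T \<longleftrightarrow>
     (\<forall>g\<in>carrier K. (\<forall>t\<in>T. alg_disjoint K t g) \<longrightarrow>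
        k \<otimes>\<^bsub>K\<^esub> g [^]\<^bsub>K\<^esub> (12::nat) = g [^]\<^bsub>K\<^esub> (12::nat) \<otimes>\<^bsub>K\<^esub> k)"

text \<open>For homeomorphisms, the trivial centraliser forces the support of every nontrivial
  element to meet the support of some member of \<open>I\<close>. Domination is by finite sets
  \<open>T\<close>, since a compactness argument delivers finite covers.\<close>

definition support_ideal :: "('g, 'm) monoid_scheme \<Rightarrow> 'g set \<Rightarrow> bool" where
  "support_ideal K I \<longleftrightarrow> I \<subseteq> carrier K \<and>
     (\<forall>v\<in>I. \<forall>h\<in>carrier K. inv\<^bsub>K\<^esub> h \<otimes>\<^bsub>K\<^esub> v \<otimes>\<^bsub>K\<^esub> h \<in> I) \<and>
     (\<forall>f\<in>carrier K. (\<forall>v\<in>I. v \<otimes>\<^bsub>K\<^esub> f = f \<otimes>\<^bsub>K\<^esub> v) \<longrightarrow> f = \<one>\<^bsub>K\<^esub>) \<and>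
     (\<forall>T k. finite T \<and> T \<subseteq> I \<and> k \<in> carrier K \<and> dominated K k T \<longrightarrow> k \<in> I)"

definition least_support_ideal :: "('g, 'm) monoid_scheme \<Rightarrow> 'g set" where
  "least_support_ideal K = {g \<in> carrier K. \<forall>I. support_ideal K I \<longrightarrow> g \<in> I}"

section \<open>Transport of the invariant along isomorphisms\<close>

context group_hom
begin

lemma hom_commutator:
  assumes "a \<in> carrier G" "b \<in> carrier G"
  shows "commutator H (h a) (h b) = h (commutator G a b)"
  using assms by (simp add: commutator_def)

end

lemma commutator_closed [simp]:
  assumes "group K" "a \<in> carrier K" "b \<in> carrier K"
  shows "commutator K a b \<in> carrier K"
proof -
  interpret group K by fact
  show ?thesis using assms by (simp add: commutator_def)
qed

lemma alg_disjoint_iso: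
  assumes "group K" "group L" and \<phi>: "\<phi> \<in> iso K L"
    and f: "f \<in> carrier K" and g: "g \<in> carrier K"
  shows "alg_disjoint L (\<phi> f) (\<phi> g) \<longleftrightarrow> alg_disjoint K f g"
proof -
  interpret K: group K by fact
  interpret L: group L by fact
  interpret group_hom K L \<phi>
    using \<phi> by unfold_locales (auto simp: iso_def)
  have inj: "\<phi> a = \<phi> b \<longleftrightarrow> a = b" if "a \<in> carrier K" "b \<in> carrier K" for a b
    using \<phi> that by (auto simp: iso_def bij_betw_def dest: inj_onD)
  have surj: "carrier L = \<phi> ` carrier K"
    using \<phi> by (auto simp: iso_def bij_betw_def)
  \<comment> \<open>Oriented against \<open>hom_mult\<close>, so that products collect under
    \<open>\<phi>\<close> until \<open>inj\<close> can cancel it; hence the deletions in the final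
    \<open>simp\<close>.\<close>
  have mult: "\<phi> a \<otimes>\<^bsub>L\<^esub> \<phi> b = \<phi> (a \<otimes>\<^bsub>K\<^esub> b)" if "a \<in> carrier K" "b \<in> carrier K" for a b
    using that by simp
  have one: "\<one>\<^bsub>L\<^esub> = \<phi> \<one>\<^bsub>K\<^esub>" by simp
  show ?thesis
    unfolding alg_disjoint_def surj ball_simps bex_simps
    using f g assms(1)
    by (simp add: mult inj one hom_commutator del: hom_mult hom_one cong: ball_cong bex_cong)
qed

lemma dominated_iso:
  assumes "group K" "group L" and \<phi>: "\<phi> \<in> iso K L"
    and k: "k \<in> carrier K" and T: "T \<subseteq> carrier K"
  shows "dominated L (\<phi> k) (\<phi> ` T) \<longleftrightarrow> dominated K k T"
proof -
  interpret K: group K by fact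
  interpret L: group L by fact
  interpret group_hom K L \<phi>
    using \<phi> by unfold_locales (auto simp: iso_def)
  have inj: "\<phi> a = \<phi> b \<longleftrightarrow> a = b" if "a \<in> carrier K" "b \<in> carrier K" for a b
    using \<phi> that by (auto simp: iso_def bij_betw_def dest: inj_onD)
  have surj: "carrier L = \<phi> ` carrier K"
    using \<phi> by (auto simp: iso_def bij_betw_def)
  have mult: "\<phi> a \<otimes>\<^bsub>L\<^esub> \<phi> b = \<phi> (a \<otimes>\<^bsub>K\<^esub> b)" if "a \<in> carrier K" "b \<in> carrier K" for a b
    using that by simp
  have pow: "\<phi> g [^]\<^bsub>L\<^esub> n = \<phi> (g [^]\<^bsub>K\<^esub> n)" if "g \<in> carrier K" for g and n :: nat
    using that by (simp add: hom_nat_pow)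
  have disj: "(\<forall>t\<in>T. alg_disjoint L (\<phi> t) (\<phi> g)) \<longleftrightarrow> (\<forall>t\<in>T. alg_disjoint K t g)"
    if "g \<in> carrier K" for g
    using alg_disjoint_iso[OF assms(1-3)] that T by blast
  show ?thesis
    unfolding dominated_def surj ball_simps
    using k by (simp add: mult inj pow disj del: hom_mult cong: ball_cong)
qed

text \<open>The clauses for \<open>J\<close> are applied to images under \<open>\<phi>\<close>.
  Surjectivity enters in the centraliser clause, where every element of \<open>J\<close> has to be
  tested.\<close>

lemma support_ideal_preimage:
  assumes "group K" "group L" and \<phi>: "\<phi> \<in> iso K L" and J: "support_ideal L J"
  shows "support_ideal K {k \<in> carrier K. \<phi> k \<in> J}"
proof -
  interpret K: group K by fact
  interpret L: group L by fact
  interpret group_hom K L \<phi>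
    using \<phi> by unfold_locales (auto simp: iso_def)
  have inj: "\<phi> a = \<phi> b \<longleftrightarrow> a = b" if "a \<in> carrier K" "b \<in> carrier K" for a b
    using \<phi> that by (auto simp: iso_def bij_betw_def dest: inj_onD)
  have surj: "carrier L = \<phi> ` carrier K"
    using \<phi> by (auto simp: iso_def bij_betw_def)
  have J1: "J \<subseteq> carrier L"
    and J2: "\<And>v h. v \<in> J \<Longrightarrow> h \<in> carrier L \<Longrightarrow> inv\<^bsub>L\<^esub> h \<otimes>\<^bsub>L\<^esub> v \<otimes>\<^bsub>L\<^esub> h \<in> J"
    and J3: "\<And>f. f \<in> carrier L \<Longrightarrow> (\<And>v. v \<in> J \<Longrightarrow> v \<otimes>\<^bsub>L\<^esub> f = f \<otimes>\<^bsub>L\<^esub> v) \<Longrightarrow> f = \<one>\<^bsub>L\<^esub>"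
    and J4: "\<And>T k. finite T \<Longrightarrow> T \<subseteq> J \<Longrightarrow> k \<in> carrier L \<Longrightarrow> dominated L k T \<Longrightarrow> k \<in> J"
    using J unfolding support_ideal_def by blast+
  let ?I = "{k \<in> carrier K. \<phi> k \<in> J}"
  have "inv\<^bsub>K\<^esub> h \<otimes>\<^bsub>K\<^esub> v \<otimes>\<^bsub>K\<^esub> h \<in> ?I" if "v \<in> ?I" "h \<in> carrier K" for v h
    using that J2[of "\<phi> v" "\<phi> h"] by simp
  moreover have "f = \<one>\<^bsub>K\<^esub>" if f: "f \<in> carrier K" and c: "\<forall>v\<in>?I. v \<otimes>\<^bsub>K\<^esub> f = f \<otimes>\<^bsub>K\<^esub> v" for f
  proof -
    have "w \<otimes>\<^bsub>L\<^esub> \<phi> f = \<phi> f \<otimes>\<^bsub>L\<^esub> w" if "w \<in> J" for w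
    proof -
      have "w \<in> \<phi> ` carrier K" using J1 that unfolding surj by blast
      then obtain v where v: "v \<in> carrier K" "w = \<phi> v" by blast
      then have "v \<otimes>\<^bsub>K\<^esub> f = f \<otimes>\<^bsub>K\<^esub> v" using c that by blast
      then show ?thesis using hom_mult[OF v(1) f] hom_mult[OF f v(1)] v(2) by simp
    qed
    then have "\<phi> f = \<one>\<^bsub>L\<^esub>" using J3 f by simp
    then show ?thesis using inj[OF f K.one_closed] by simp
  qed
  moreover have "k \<in> ?I"
    if "finite T" "T \<subseteq> ?I" "k \<in> carrier K" "dominated K k T" for T k
  proof -
    have "dominated L (\<phi> k) (\<phi> ` T)"
      using dominated_iso[OF assms(1-3), of k T] that by blast
    then show ?thesis using J4[of "\<phi> ` T" "\<phi> k"] that by auto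
  qed
  ultimately show ?thesis
    unfolding support_ideal_def by (intro conjI ballI allI impI) auto
qed

text \<open>Every ideal of \<open>L\<close> pulls back to an ideal of \<open>K\<close>, so an
  element lying in all ideals of \<open>K\<close> has its image in all ideals of
  \<open>L\<close>.\<close>

lemma least_support_ideal_iso_subset:
  assumes "group K" "group L" and \<phi>: "\<phi> \<in> iso K L"
  shows "\<phi> ` least_support_ideal K \<subseteq> least_support_ideal L"
proof
  fix w assume "w \<in> \<phi> ` least_support_ideal K"
  then obtain g where g: "g \<in> least_support_ideal K" "w = \<phi> g" by blast
  then have "w \<in> carrier L"
    using \<phi> by (auto simp: least_support_ideal_def iso_def hom_def)
  moreover have "w \<in> J" if "support_ideal L J" for J
    using support_ideal_preimage[OF assms that] g by (auto simp: least_support_ideal_def)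
  ultimately show "w \<in> least_support_ideal L"
    by (simp add: least_support_ideal_def)
qed

lemma least_support_ideal_iso:
  assumes "group K" "group L" and \<phi>: "\<phi> \<in> iso K L"
  shows "\<phi> ` least_support_ideal K = least_support_ideal L"
proof -
  let ?\<psi> = "inv_into (carrier K) \<phi>"
  have bij: "bij_betw \<phi> (carrier K) (carrier L)" using \<phi> by (simp add: iso_def)
  have "?\<psi> \<in> iso L K" using group.iso_set_sym[OF assms(1) \<phi>] .
  from least_support_ideal_iso_subset[OF assms(2,1) this] have "?\<psi> ` least_support_ideal L \<subseteq> least_support_ideal K" .
  moreover have "w = \<phi> (?\<psi> w)" if "w \<in> least_support_ideal L" for w
    using that bij by (simp add: least_support_ideal_def bij_betw_inv_into_right)
  ultimately have "least_support_ideal L \<subseteq> \<phi> ` least_support_ideal K" by blast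
  then show ?thesis using least_support_ideal_iso_subset[OF assms] by blast
qed

text \<open>First isomorphism theorem for the composite of \<open>\<phi>\<close> with the projection
  to \<open>L Mod M\<close>: it is onto with kernel \<open>N\<close>.\<close>

lemma FactGroup_iso_cong:
  assumes "group K" "group L" and \<phi>: "\<phi> \<in> iso K L"
    and N: "N \<lhd> K" and M: "M \<lhd> L" and NM: "\<phi> ` N = M"
  shows "K Mod N \<cong> L Mod M"
proof -
  interpret K: group K by fact
  interpret L: group L by fact
  interpret M: normal M L by fact
  interpret N: normal N K by fact
  interpret LM: group "L Mod M" by (rule M.factorgroup_is_group)
  have bij: "bij_betw \<phi> (carrier K) (carrier L)" and hom: "\<phi> \<in> hom K L"
    using \<phi> by (auto simp: iso_def)
  let ?\<pi> = "\<lambda>a. M #>\<^bsub>L\<^esub> \<phi> a"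
  have "?\<pi> \<in> hom K (L Mod M)"
    using hom_compose[OF hom M.r_coset_hom_Mod] by (simp add: comp_def)
  then interpret \<pi>: group_hom K "L Mod M" ?\<pi>
    by unfold_locales
  have onto: "?\<pi> ` carrier K = carrier (L Mod M)"
  proof -
    have "?\<pi> ` carrier K = (\<lambda>b. M #>\<^bsub>L\<^esub> b) ` (\<phi> ` carrier K)" by (simp add: image_image)
    then show ?thesis
      using bij by (auto simp: bij_betw_def FactGroup_def RCOSETS_def)
  qed
  have ker: "kernel K (L Mod M) ?\<pi> = N"
  proof -
    have "M #>\<^bsub>L\<^esub> \<phi> a = M \<longleftrightarrow> a \<in> N" if a: "a \<in> carrier K" for a
    proof -
      have c: "\<phi> a \<in> carrier L" using a hom by (auto simp: hom_def)
      have "M #>\<^bsub>L\<^esub> \<phi> a = M \<longleftrightarrow> \<phi> a \<in> M"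
        using c L.coset_join1[OF _ c M.is_subgroup] L.coset_join2[OF c M.is_subgroup]
        by blast
      also have "\<dots> \<longleftrightarrow> a \<in> N"
        using NM bij a N.subset by (auto simp: bij_betw_def dest: inj_onD)
      finally show ?thesis .
    qed
    then show ?thesis using N.subset by (auto simp: kernel_def FactGroup_def)
  qed
  show ?thesis using \<pi>.FactGroup_iso[OF onto] ker by simp
qed


section \<open>Locally moving groups of homeomorphisms\<close>

lemma displaced_nhd:
  fixes g :: "'a::t2_space \<Rightarrow> 'a"
  assumes "continuous_on UNIV g" "g p \<noteq> p"
  obtains W where "open W" "p \<in> W" "\<And>z. z \<in> W \<Longrightarrow> g z \<notin> W"
proof -
  obtain A B where AB: "open A" "open B" "p \<in> A" "g p \<in> B" "A \<inter> B = {}"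
    using hausdorff[OF assms(2)[symmetric]] by blast
  show thesis
  proof (rule that[of "A \<inter> g -` B"])
    show "open (A \<inter> g -` B)" using AB assms(1) by (simp add: open_Int open_vimage)
  qed (use AB in auto)
qed

text \<open>Each power displaces a neighbourhood of its own; a finite intersection serves all of
  them at once.\<close>

lemma displaced_nhds:
  fixes g :: "'a::t2_space \<Rightarrow> 'a"
  assumes "continuous_on UNIV g" "open V" "p \<in> V" and ne: "\<forall>d\<in>{1..n}. (g ^^ d) p \<noteq> p"
  obtains W where "open W" "p \<in> W" "W \<subseteq> V" "\<forall>d\<in>{1..n}. \<forall>z\<in>W. (g ^^ d) z \<notin> W"
proof -
  have "continuous_on UNIV (g ^^ d)" for d
  proof (induction d)
    case (Suc d)
    then show ?case
      unfolding funpow.simps by (intro continuous_on_compose continuous_on_subset[OF assms(1)]) auto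
  qed (simp add: id_def continuous_on_id)
  then have "\<forall>d\<in>{1..n}. \<exists>W. open W \<and> p \<in> W \<and> (\<forall>z\<in>W. (g ^^ d) z \<notin> W)"
    using displaced_nhd[of "g ^^ d" p for d] ne by metis
  then obtain W where W: "\<And>d. d \<in> {1..n} \<Longrightarrow> open (W d) \<and> p \<in> W d \<and> (\<forall>z\<in>W d. (g ^^ d) z \<notin> W d)"
    by metis
  show thesis
  proof (rule that[of "V \<inter> (\<Inter>d\<in>{1..n}. W d)"])
    show "open (V \<inter> (\<Inter>d\<in>{1..n}. W d))" using W assms(2) by (intro open_Int open_INT) auto
    show "p \<in> V \<inter> (\<Inter>d\<in>{1..n}. W d)" using W assms(3) by blast
    show "V \<inter> (\<Inter>d\<in>{1..n}. W d) \<subseteq> V" by blast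
    show "\<forall>d\<in>{1..n}. \<forall>z\<in>V \<inter> (\<Inter>d\<in>{1..n}. W d). (g ^^ d) z \<notin> V \<inter> (\<Inter>d\<in>{1..n}. W d)"
      using W by blast
  qed
qed

text \<open>By injectivity, a point moved by \<open>f\<close> is sent to another point moved by
  \<open>f\<close>, and \<open>g\<close> fixes both; likewise with the roles exchanged.\<close>

lemma disjoint_supports_commute:
  assumes "inj f" "inj g" and disj: "\<And>z. f z = z \<or> g z = z"
  shows "f \<circ> g = g \<circ> f"
proof
  fix z
  show "(f \<circ> g) z = (g \<circ> f) z"
    using disj[of z] disj[of "f z"] disj[of "g z"] injD[OF assms(1), of "f z" z]
      injD[OF assms(2), of "g z" z] by (metis comp_apply)
qed

text \<open>The point x stands for the deleted point: the space on which H is locally moving is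
  the complement of x.\<close>

locale locally_moving =
  fixes H :: "('a::t2_space \<Rightarrow> 'a) set" and x :: 'a
  assumes subgroup_H: "subgroup H homeo_group"
    and fixes_x: "\<And>h. h \<in> H \<Longrightarrow> h x = x"
    and moving: "\<And>U p. open U \<Longrightarrow> x \<notin> U \<Longrightarrow> p \<in> U \<Longrightarrow> \<exists>g\<in>Rist H U. g p \<noteq> p"
begin

sublocale K: group "homeos H"
  using group.subgroup_imp_group[OF group_homeo_group subgroup_H] .

abbreviation inv_H :: "('a \<Rightarrow> 'a) \<Rightarrow> ('a \<Rightarrow> 'a)" where
  "inv_H g \<equiv> inv\<^bsub>homeos H\<^esub> g"

lemma inv_simps [simp]:
  assumes "g \<in> H"
  shows "inv_H g (g z) = z" "g (inv_H g z) = z"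
  using group.m_inv_consistent[OF group_homeo_group subgroup_H assms] inv_homeo_group[of g z]
    subgroup.subset[OF subgroup_H] assms by auto

lemma inv_closed [simp]: "g \<in> H \<Longrightarrow> inv_H g \<in> H"
  using K.inv_closed by simp

lemma comp_closed [simp]: "f \<in> H \<Longrightarrow> g \<in> H \<Longrightarrow> f \<circ> g \<in> H"
  using K.m_closed[of f g] by simp

lemma id_closed [simp]: "id \<in> H"
  using K.one_closed by simp

lemma funpow_closed [simp]: "g \<in> H \<Longrightarrow> g ^^ n \<in> H"
  by (induction n) (simp_all)

lemma nat_pow_eq_funpow: "g [^]\<^bsub>homeos H\<^esub> (n::nat) = g ^^ n"
proof (induction n)
  case (Suc n)
  have "g [^]\<^bsub>homeos H\<^esub> Suc n = g ^^ n \<circ> g" using Suc by simp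
  then show ?case by (simp only: funpow_Suc_right)
qed simp

lemma inj_H: "g \<in> H \<Longrightarrow> inj g"
  by (metis injI inv_simps(1))

lemma continuous_H: "g \<in> H \<Longrightarrow> continuous_on UNIV g"
  using subgroup.subset[OF subgroup_H] carrier_homeo_group homeomorphic_imp_continuous_map
  by (metis continuous_map_iff_continuous2 subsetD)

lemma open_support: "g \<in> H \<Longrightarrow> open {z. g z \<noteq> z}"
  by (intro open_Collect_neq continuous_H continuous_on_id)

lemma x_not_in_support: "g \<in> H \<Longrightarrow> x \<notin> {z. g z \<noteq> z}"
  by (simp add: fixes_x)

section \<open>Noncommuting and long-orbit elements in rigid stabilisers\<close>

lemma RistD:
  assumes "g \<in> Rist H U"
  shows "g \<in> H" "z \<notin> U \<Longrightarrow> g z = z"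
  using assms by (auto simp: Rist_def)

lemma Rist_inv:
  assumes "g \<in> Rist H U"
  shows "inv_H g \<in> Rist H U"
proof -
  have "inv_H g z = z" if "z \<notin> U" for z
    using inv_simps(1)[OF RistD(1)[OF assms], of z] RistD(2)[OF assms that] by simp
  then show ?thesis using inv_closed[OF RistD(1)[OF assms]] by (simp add: Rist_def)
qed

lemma Rist_comp: "f \<in> Rist H U \<Longrightarrow> g \<in> Rist H U \<Longrightarrow> f \<circ> g \<in> Rist H U"
  by (auto simp: Rist_def)

text \<open>If the two commuted, \<open>r\<close> would move \<open>g z\<close> because it moves
  \<open>z\<close>; but \<open>g z\<close> lies outside \<open>V\<close>, where \<open>r\<close> is
  trivial.\<close>

lemma not_commute_if_displaced:
  assumes "r \<in> Rist H V" "r z \<noteq> z" and V: "\<And>w. w \<in> V \<Longrightarrow> g w \<notin> V" and "g \<in> H"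
  shows "g \<circ> r \<noteq> r \<circ> g"
proof
  assume "g \<circ> r = r \<circ> g"
  then have "g (r z) = r (g z)" by (metis comp_apply)
  moreover have "z \<in> V" using assms(1,2) by (auto simp: Rist_def)
  ultimately have "g (r z) = g z" using V assms(1) by (auto simp: Rist_def)
  then show False using assms(2) inj_H[OF \<open>g \<in> H\<close>] by (auto dest: injD)
qed

text \<open>The second element is supported in a neighbourhood that the first one displaces.\<close>

lemma Rist_not_commutative:
  assumes U: "open U" "x \<notin> U" "p \<in> U"
  obtains a b where "a \<in> Rist H U" "b \<in> Rist H U" "a \<circ> b \<noteq> b \<circ> a"
proof -
  obtain a where a: "a \<in> Rist H U" "a p \<noteq> p" using moving U by blast
  obtain V where V: "open V" "p \<in> V" "\<And>z. z \<in> V \<Longrightarrow> a z \<notin> V"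
    using displaced_nhd[OF continuous_H] a RistD by metis
  obtain b where b: "b \<in> Rist H (U \<inter> V)" "b p \<noteq> p" using moving[of "U \<inter> V" p] U V by auto
  have "a \<circ> b \<noteq> b \<circ> a"
    using not_commute_if_displaced[OF b] V a RistD by auto
  moreover have "b \<in> Rist H U" using b by (auto simp: Rist_def)
  ultimately show thesis using that a by blast
qed

text \<open>Induction on \<open>n\<close>. If the \<open>g\<close>-orbit of \<open>p\<close> closes
  up at time \<open>Suc n\<close>, composing with an \<open>r\<close> that moves \<open>p\<close>
  within a small set reopens it without closing it earlier.\<close>

lemma Rist_long_orbit:
  assumes U: "open U" "x \<notin> U" "p \<in> U"
  shows "\<exists>g\<in>Rist H U. \<forall>d\<in>{1..n}. (g ^^ d) p \<noteq> p"
proof (induction n)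
  case 0
  have "id \<in> Rist H U" by (simp add: Rist_def)
  then show ?case by auto
next
  case (Suc n)
  then obtain g where g: "g \<in> Rist H U" "\<forall>d\<in>{1..n}. (g ^^ d) p \<noteq> p" by blast
  have gH: "g \<in> H" using g RistD by blast
  show ?case
  proof (cases "(g ^^ Suc n) p = p")
    case False
    then show ?thesis using g by (metis atLeastAtMostSuc_conv insertE le_add1 plus_1_eq_Suc)
  next
    case True
    obtain V where V: "open V" "p \<in> V" "V \<subseteq> U" "\<forall>d\<in>{1..n}. \<forall>z\<in>V. (g ^^ d) z \<notin> V"
      using displaced_nhds[OF continuous_H[OF gH] U(1,3) g(2)] .
    obtain r where r: "r \<in> Rist H V" "r p \<noteq> p" using moving[of V p] V U by auto
    \<comment> \<open>Otherwise \<open>r\<close> would fix \<open>r p\<close> and then, by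
      injectivity, also \<open>p\<close>.\<close>
    have rp: "r p \<in> V"
      using r V(2) inj_H[OF RistD(1)[OF r(1)]] by (metis RistD(2) injD)
    define k where "k = g \<circ> r"
    have k: "k z = g (r z)" for z by (simp add: k_def)
    \<comment> \<open>\<open>r\<close> acts only at the first step: the points
      \<open>(g ^^ d) (r p)\<close> with \<open>1 \<le> d \<le> n\<close> lie outside
      \<open>V\<close>, so \<open>k\<close> follows the \<open>g\<close>-orbit of
      \<open>r p\<close>.\<close>
    have pow: "(k ^^ Suc d) p = (g ^^ Suc d) (r p)" if "d \<le> n" for d
      using that
    proof (induction d)
      case (Suc d)
      then have "(k ^^ Suc d) p = (g ^^ Suc d) (r p)" by (simp only: Suc_leD)
      then have "k ((k ^^ Suc d) p) = k ((g ^^ Suc d) (r p))" by (rule arg_cong)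
      then have "(k ^^ Suc (Suc d)) p = k ((g ^^ Suc d) (r p))" by simp
      also have "\<dots> = g (r ((g ^^ Suc d) (r p)))" by (rule k)
      also have "\<dots> = g ((g ^^ Suc d) (r p))"
      proof -
        have "Suc d \<in> {1..n}" using Suc.prems by simp
        then have "(g ^^ Suc d) (r p) \<notin> V" using V(4) rp by blast
        then show ?thesis using RistD(2)[OF r(1)] by metis
      qed
      finally show ?case by simp
    qed (simp add: k)
    have "(k ^^ d) p \<noteq> p" if "d \<in> {1..Suc n}" for d
    proof (cases "d = Suc n")
      case True
      have "(g ^^ Suc n) (r p) \<noteq> (g ^^ Suc n) p"
        using r(2) inj_H[OF funpow_closed[OF gH]] by (meson injD)
      then show ?thesis using pow[of n] \<open>(g ^^ Suc n) p = p\<close> True by simp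
    next
      case False
      then have d: "d \<in> {1..n}" using that by auto
      then obtain e where e: "d = Suc e" "e \<le> n" by (cases d) auto
      then show ?thesis using pow[OF e(2)] V(2,4) rp d by metis
    qed
    moreover have "k \<in> Rist H U"
      unfolding k_def using g r V(3) by (auto simp: Rist_def)
    ultimately show ?thesis by blast
  qed
qed

section \<open>Algebraic disjointness versus disjointness of supports\<close>

lemma commutator_apply:
  "commutator (homeos H) a b z = a (b (inv_H a (inv_H b z)))"
  by (simp add: commutator_def)

text \<open>Choose V inside the support of f with h V disjoint from V. For b in Rist V, conjugating by h
  gives a map that commutes with Rist V, so for a in Rist V the double commutator of a, b and h is
  just the commutator of a and b.\<close>

lemma alg_disjointI:
  assumes f: "f \<in> H" and g: "g \<in> H" and disj: "\<And>z. f z = z \<or> g z = z"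
  shows "alg_disjoint (homeos H) f g"
  unfolding alg_disjoint_def
proof (intro ballI impI)
  fix h assume "h \<in> carrier (homeos H)" and ne: "f \<otimes>\<^bsub>homeos H\<^esub> h \<noteq> h \<otimes>\<^bsub>homeos H\<^esub> f"
  then have h: "h \<in> H" by simp
  \<comment> \<open>As \<open>f\<close> and \<open>h\<close> do not commute, their supports meet;
    \<open>p\<close> is taken in the intersection.\<close>
  have "\<not> (\<forall>z. f z = z \<or> h z = z)"
    using disjoint_supports_commute[of f h] inj_H f h ne by auto
  then obtain p where p: "f p \<noteq> p" "h p \<noteq> p" by blast
  obtain V where V: "open V" "p \<in> V" "\<And>z. z \<in> V \<Longrightarrow> h z \<notin> V"
    using displaced_nhd[OF continuous_H[OF h] p(2)] by metis
  let ?V = "V \<inter> {z. f z \<noteq> z}"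
  have oV: "open ?V" "x \<notin> ?V" "p \<in> ?V"
    using V open_support[OF f] x_not_in_support[OF f] p by auto
  obtain a b where ab: "a \<in> Rist H ?V" "b \<in> Rist H ?V" "a \<circ> b \<noteq> b \<circ> a"
    using Rist_not_commutative[OF oV] .
  have aH: "a \<in> H" and bH: "b \<in> H" using ab RistD by auto
  have commute_g: "r \<circ> g = g \<circ> r" if "r \<in> Rist H ?V" for r
    using disjoint_supports_commute[of r g] inj_H g that disj by (auto simp: Rist_def)
  let ?k = "commutator (homeos H) a (commutator (homeos H) b h)"
  define c where "c = h \<circ> inv_H b \<circ> inv_H h"
  have cH: "c \<in> H" using aH bH h by (simp add: c_def)
  have c_fix: "c z = z" if "z \<in> ?V" for z
  proof -
    have "inv_H h z \<notin> ?V" using V(3)[of "inv_H h z"] that h by auto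
    then have "inv_H b (inv_H h z) = inv_H h z" using RistD(2)[OF Rist_inv[OF ab(2)]] by blast
    then show ?thesis using h by (simp add: c_def)
  qed
  have commute_c: "c \<circ> r = r \<circ> c" if "r \<in> Rist H ?V" for r
    using disjoint_supports_commute[of c r] inj_H cH that c_fix by (auto simp: Rist_def)
  have w: "commutator (homeos H) b h = b \<circ> c"
    by (simp add: commutator_def c_def comp_assoc)
  have k: "?k = a \<circ> b \<circ> inv_H a \<circ> inv_H b"
  proof -
    have "?k = a \<circ> b \<circ> (c \<circ> inv_H a) \<circ> inv_H (b \<circ> c)"
      unfolding w by (simp add: commutator_def comp_assoc)
    also have "\<dots> = a \<circ> b \<circ> (inv_H a \<circ> c) \<circ> (inv_H c \<circ> inv_H b)"
      using commute_c[OF Rist_inv[OF ab(1)]] K.inv_mult_group[of b c] bH cH by simp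
    also have "\<dots> = a \<circ> b \<circ> inv_H a \<circ> inv_H b"
      using cH by (simp add: fun_eq_iff)
    finally show ?thesis .
  qed
  have "?k \<in> Rist H ?V"
    unfolding k using ab by (intro Rist_comp Rist_inv)
  moreover have "?k \<noteq> id"
  proof
    assume "?k = id"
    then have "a (b (inv_H a (inv_H b z))) = z" for z unfolding k by (metis comp_apply id_apply)
    \<comment> \<open>The instance \<open>b (a z)\<close> cancels both inverses.\<close>
    from this[of "b (a z)" for z] have "a (b z) = b (a z)" for z using aH bH by simp
    then show False using ab(3) by auto
  qed
  ultimately show "\<exists>a\<in>carrier (homeos H). \<exists>b\<in>carrier (homeos H).
      a \<otimes>\<^bsub>homeos H\<^esub> g = g \<otimes>\<^bsub>homeos H\<^esub> a \<and> b \<otimes>\<^bsub>homeos H\<^esub> g = g \<otimes>\<^bsub>homeos H\<^esub> b \<and>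
      commutator (homeos H) a (commutator (homeos H) b h) \<noteq> \<one>\<^bsub>homeos H\<^esub> \<and>
      commutator (homeos H) a (commutator (homeos H) b h) \<otimes>\<^bsub>homeos H\<^esub> g =
      g \<otimes>\<^bsub>homeos H\<^esub> commutator (homeos H) a (commutator (homeos H) b h)"
    using commute_g ab(1,2) aH bH by (intro bexI[of _ a] bexI[of _ b]) auto
qed

text \<open>For h supported in U, the double commutator of a, b and h is supported in four translates
  of U by elements commuting with g. By pigeonhole, two of any five consecutive points of a g-orbit
  in its support lie in the same translate, so U meets one of its images under g, ..., g^4.\<close>

lemma alg_disjoint_short_orbit:
  assumes f: "f \<in> H" and g: "g \<in> H" and "alg_disjoint (homeos H) f g" and p: "f p \<noteq> p"
  shows "\<exists>d\<in>{1..4}. (g ^^ d) p = p"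
proof (rule ccontr)
  assume "\<not> ?thesis"
  then have long: "\<forall>d\<in>{1..4}. (g ^^ d) p \<noteq> p" by blast
  obtain V where V: "open V" "p \<in> V" "\<And>z. z \<in> V \<Longrightarrow> f z \<notin> V"
    using displaced_nhd[OF continuous_H[OF f] p] by metis
  have Vf: "open (V \<inter> {z. f z \<noteq> z})" "p \<in> V \<inter> {z. f z \<noteq> z}"
    using V open_support[OF f] p by auto
  \<comment> \<open>\<open>U\<close> is shrunk for two purposes: \<open>f\<close> displaces it, so a
    nontrivial \<open>h\<close> supported in it cannot commute with \<open>f\<close>; and the first
    four powers of \<open>g\<close> displace it, which the pigeonhole argument will
    contradict.\<close>
  obtain U where U: "open U" "p \<in> U" "U \<subseteq> V \<inter> {z. f z \<noteq> z}"
    and gU: "\<forall>d\<in>{1..4}. \<forall>z\<in>U. (g ^^ d) z \<notin> U"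
    using displaced_nhds[OF continuous_H[OF g] Vf long] .
  have "x \<notin> U" using U(3) fixes_x[OF f] by auto
  then obtain h where h: "h \<in> Rist H U" "h p \<noteq> p" using moving U by blast
  have hH: "h \<in> H" using h RistD by blast
  have "f \<circ> h \<noteq> h \<circ> f"
    using not_commute_if_displaced[OF h _ f] V(3) U(3) by blast
  then obtain a b where aH: "a \<in> H" and bH: "b \<in> H"
    and ag: "a \<circ> g = g \<circ> a" and bg: "b \<circ> g = g \<circ> b"
    and k1: "commutator (homeos H) a (commutator (homeos H) b h) \<noteq> id"
    and kg: "commutator (homeos H) a (commutator (homeos H) b h) \<circ> g =
       g \<circ> commutator (homeos H) a (commutator (homeos H) b h)"
    using assms(3) hH unfolding alg_disjoint_def by auto
  define w where "w = commutator (homeos H) b h"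
  define k where "k = commutator (homeos H) a w"
  have wH: "w \<in> H" using bH hH by (simp add: w_def commutator_def)
  \<comment> \<open>The translating elements: \<open>w\<close> is supported in \<open>U\<close> and
    its image under \<open>b\<close>, and \<open>k\<close> in these two sets and their images under
    \<open>a\<close>.\<close>
  define E where "E = {id, a, b, a \<circ> b}"
  have E: "e \<in> H" "e \<circ> g = g \<circ> e" if "e \<in> E" for e
  proof -
    show "e \<in> H" using that aH bH by (auto simp: E_def)
    show "e \<circ> g = g \<circ> e" using that ag bg by (auto simp: E_def fun_eq_iff)
  qed
  have w_fix: "w z = z" "inv_H w z = z" if "z \<notin> U" "inv_H b z \<notin> U" for z
  proof -
    have hf: "h y = y" "inv_H h y = y" if "y \<notin> U" for y
      using RistD(2) h(1) Rist_inv that by blast+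
    show "w z = z" using that hf bH hH by (simp add: w_def commutator_apply)
    then show "inv_H w z = z" using wH by (metis inv_simps(1))
  qed
  have supp: "\<exists>e\<in>E. inv_H e z \<in> U" if "k z \<noteq> z" for z
  proof (rule ccontr)
    assume "\<not> ?thesis"
    then have "inv_H id z \<notin> U" "inv_H a z \<notin> U" "inv_H b z \<notin> U" "inv_H (a \<circ> b) z \<notin> U"
      by (auto simp: E_def)
    moreover have "inv_H id z = z" by (metis id_apply id_closed inv_simps(1))
    moreover have "inv_H (a \<circ> b) z = inv_H b (inv_H a z)"
      using K.inv_mult_group[of a b] aH bH by simp
    ultimately have "inv_H w z = z" "w (inv_H a z) = inv_H a z" using w_fix by simp_all
    then show False using that aH by (simp add: k_def commutator_apply)
  qed
  obtain q where q: "k q \<noteq> q" using k1 unfolding k_def w_def by (auto simp: fun_eq_iff)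
  have kH: "k \<in> H" using aH wH by (simp add: k_def commutator_def)
  have commute_pow: "e ((g ^^ i) z) = (g ^^ i) (e z)" if "e \<circ> g = g \<circ> e" for e i z
    using that by (induction i) (simp_all, metis comp_apply)
  \<comment> \<open>\<open>k\<close> commutes with \<open>g\<close>, so it moves every point of the
    forward \<open>g\<close>-orbit of \<open>q\<close>.\<close>
  have "k ((g ^^ i) q) \<noteq> (g ^^ i) q" for i
    using q commute_pow[of k i q] kg inj_H[OF funpow_closed[OF g], of i]
    unfolding k_def w_def by (auto dest: injD)
  then have "\<forall>i. \<exists>e\<in>E. inv_H e ((g ^^ i) q) \<in> U" using supp by blast
  then obtain e where e: "\<And>i. e i \<in> E" "\<And>i. inv_H (e i) ((g ^^ i) q) \<in> U" by metis
  have "card E \<le> 4" unfolding E_def by (simp add: card_insert_if)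
  moreover have "card (e ` {..4::nat}) \<le> card E"
    using e(1) by (intro card_mono) (auto simp: E_def)
  ultimately have "\<not> inj_on e {..4::nat}" by (auto dest: card_image)
  then obtain i j where ij: "i < j" "j \<le> 4" "e i = e j"
    unfolding inj_on_def by (metis atMost_iff linorder_neqE_nat)
  let ?z = "inv_H (e i) ((g ^^ i) q)"
  \<comment> \<open>Undoing the common translate \<open>e i\<close>, which commutes with
    \<open>g\<close>, leaves two points of \<open>U\<close> with \<open>g ^^ (j - i)\<close> taking
    one to the other.\<close>
  have "e j ((g ^^ (j - i)) ?z) = (g ^^ (j - i)) (e i ?z)"
    using commute_pow[OF E(2)[OF e(1)], of j "j - i" ?z] ij by simp
  also have "\<dots> = (g ^^ (j - i)) ((g ^^ i) q)" using E(1)[OF e(1)] by simp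
  also have "\<dots> = (g ^^ j) q" using ij by (metis comp_apply funpow_add le_add_diff_inverse2 less_imp_le)
  finally have "(g ^^ (j - i)) ?z = inv_H (e j) ((g ^^ j) q)"
    using E(1)[OF e(1)] by (metis inv_simps(1))
  then have "(g ^^ (j - i)) ?z \<in> U" using e(2) by simp
  moreover have "(g ^^ (j - i)) ?z \<notin> U" using gU e(2)[of i] ij by (simp add: Suc_leI)
  ultimately show False by simp
qed

lemma alg_disjointD:
  assumes "f \<in> H" "g \<in> H" "alg_disjoint (homeos H) f g" "f p \<noteq> p"
  shows "(g ^^ 12) p = p"
proof -
  obtain d where d: "d \<in> {1..4}" "(g ^^ d) p = p"
    using alg_disjoint_short_orbit[OF assms] by blast
  have "d dvd 12"
  proof -
    have "d = 1 \<or> d = 2 \<or> d = 3 \<or> d = 4" using d(1) by auto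
    then show ?thesis by auto
  qed
  then obtain m where "12 = d * m" by blast
  moreover have "((g ^^ d) ^^ m) p = p" using d(2) by (induction m) simp_all
  ultimately show ?thesis by (simp add: funpow_mult mult.commute)
qed

section \<open>Domination as inclusion of supports\<close>

lemma dominatedI:
  assumes k: "k \<in> H" and T: "T \<subseteq> H" and supp: "\<And>z. k z \<noteq> z \<Longrightarrow> \<exists>t\<in>T. t z \<noteq> z"
  shows "dominated (homeos H) k T"
  unfolding dominated_def
proof (intro ballI impI)
  fix g assume "g \<in> carrier (homeos H)" and d: "\<forall>t\<in>T. alg_disjoint (homeos H) t g"
  then have g: "g \<in> H" by simp
  \<comment> \<open>A point moved by \<open>k\<close> is moved by some \<open>t\<close> in
    \<open>T\<close>, so \<open>alg_disjointD\<close> applies there.\<close>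
  have "k z = z \<or> (g ^^ 12) z = z" for z
    using supp[of z] alg_disjointD[OF _ g, of _ z] d T by blast
  then have "k \<circ> (g ^^ 12) = (g ^^ 12) \<circ> k"
    using disjoint_supports_commute[of k "g ^^ 12"] inj_H k g by auto
  then show "k \<otimes>\<^bsub>homeos H\<^esub> g [^]\<^bsub>homeos H\<^esub> (12::nat) = g [^]\<^bsub>homeos H\<^esub> (12::nat) \<otimes>\<^bsub>homeos H\<^esub> k"
    by (simp add: nat_pow_eq_funpow)
qed

text \<open>Converse of \<open>dominatedI\<close> up to closure. If \<open>k\<close> moved
  \<open>p\<close>, the open set \<open>W\<close> would leave room for some \<open>g\<close>
  supported near \<open>p\<close>, disjoint from all of \<open>T\<close>, whose twelfth power does
  not commute with \<open>k\<close>.\<close>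

lemma dominatedD:
  assumes k: "k \<in> H" and T: "T \<subseteq> H" and dom: "dominated (homeos H) k T"
    and W: "open W" "\<And>t z. t \<in> T \<Longrightarrow> z \<in> W \<Longrightarrow> t z = z" and "p \<in> W"
  shows "k p = p"
proof (rule ccontr)
  assume kp: "k p \<noteq> p"
  obtain V where V: "open V" "p \<in> V" "\<And>z. z \<in> V \<Longrightarrow> k z \<notin> V"
    using displaced_nhd[OF continuous_H[OF k] kp] by metis
  let ?U = "V \<inter> W \<inter> {z. k z \<noteq> z}"
  have U: "open ?U" "x \<notin> ?U" "p \<in> ?U"
    using V W \<open>p \<in> W\<close> open_support[OF k] fixes_x[OF k] kp by auto
  \<comment> \<open>Moving \<open>p\<close> by \<open>g\<close> alone would not suffice: the twelfth
    power must move it too.\<close>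
  obtain g where g: "g \<in> Rist H ?U" "(g ^^ 12) p \<noteq> p"
    using Rist_long_orbit[OF U, of 12] by auto
  have gH: "g \<in> H" using g RistD by blast
  have "t z = z \<or> g z = z" if "t \<in> T" for t z
    using W(2)[OF that] RistD(2)[OF g(1)] by blast
  then have "\<forall>t\<in>T. alg_disjoint (homeos H) t g" using alg_disjointI T gH by blast
  then have "k \<circ> (g ^^ 12) = (g ^^ 12) \<circ> k"
    using dom gH unfolding dominated_def by (auto simp: nat_pow_eq_funpow)
  moreover have "g ^^ 12 \<in> Rist H ?U"
  proof -
    have "(g ^^ n) z = z" if "z \<notin> ?U" for n z
      using RistD(2)[OF g(1) that] by (induction n) simp_all
    then show ?thesis using gH funpow_closed by (simp add: Rist_def)
  qed
  ultimately show False
    using not_commute_if_displaced[of "g ^^ 12" ?U p k] g(2) k V(3) by blast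
qed

section \<open>Elements with trivial germ at \<open>x\<close> form the least ideal\<close>

definition trivial_germs :: "('a \<Rightarrow> 'a) set" where
  "trivial_germs = {g \<in> H. \<exists>W. open W \<and> x \<in> W \<and> (\<forall>z\<in>W. g z = z)}"

text \<open>Conjugation preserves triviality near \<open>x\<close> because \<open>h\<close> fixes
  \<open>x\<close>. Maps supported away from \<open>x\<close> already have trivial centraliser. For
  domination, intersect finitely many neighbourhoods of \<open>x\<close> and apply
  \<open>dominatedD\<close>.\<close>

lemma support_ideal_trivial_germs: "support_ideal (homeos H) trivial_germs"
  unfolding support_ideal_def
proof (intro conjI ballI allI impI)
  show "trivial_germs \<subseteq> carrier (homeos H)" by (auto simp: trivial_germs_def)
next
  fix v h assume v: "v \<in> trivial_germs" and "h \<in> carrier (homeos H)"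
  then have h: "h \<in> H" by simp
  from v obtain W where W: "v \<in> H" "open W" "x \<in> W" "\<And>z. z \<in> W \<Longrightarrow> v z = z"
    by (auto simp: trivial_germs_def)
  have "open (h -` W)" using W continuous_H[OF h] by (simp add: open_vimage)
  moreover have "x \<in> h -` W" using W fixes_x[OF h] by simp
  moreover have "\<forall>z\<in>h -` W. (inv_H h \<circ> v \<circ> h) z = z" using W h by simp
  ultimately have "inv_H h \<circ> v \<circ> h \<in> trivial_germs"
    unfolding trivial_germs_def using W(1) h by (auto intro!: exI[of _ "h -` W"])
  then show "inv_H h \<otimes>\<^bsub>homeos H\<^esub> v \<otimes>\<^bsub>homeos H\<^esub> h \<in> trivial_germs" by simp
next
  fix f assume "f \<in> carrier (homeos H)"
    and c: "\<forall>v\<in>trivial_germs. v \<otimes>\<^bsub>homeos H\<^esub> f = f \<otimes>\<^bsub>homeos H\<^esub> v"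
  then have f: "f \<in> H" by simp
  have "f p = p" for p
  proof (rule ccontr)
    assume fp: "f p \<noteq> p"
    then have "p \<noteq> x" using fixes_x[OF f] by auto
    then obtain A B where AB: "open A" "open B" "p \<in> A" "x \<in> B" "A \<inter> B = {}"
      using hausdorff[of p x] by blast
    obtain V where V: "open V" "p \<in> V" "\<And>z. z \<in> V \<Longrightarrow> f z \<notin> V"
      using displaced_nhd[OF continuous_H[OF f] fp] by metis
    obtain r where r: "r \<in> Rist H (V \<inter> A)" "r p \<noteq> p"
      using moving[of "V \<inter> A" p] V AB by auto
    have "r \<in> trivial_germs"
      unfolding trivial_germs_def using r AB by (auto simp: Rist_def)
    then have "f \<circ> r = r \<circ> f" using c by simp
    then show False using not_commute_if_displaced[OF r _ f] V(3) by blast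
  qed
  then show "f = \<one>\<^bsub>homeos H\<^esub>" by auto
next
  fix T k assume "finite T \<and> T \<subseteq> trivial_germs \<and> k \<in> carrier (homeos H) \<and> dominated (homeos H) k T"
  then have T: "finite T" "T \<subseteq> trivial_germs" and k: "k \<in> H" and dom: "dominated (homeos H) k T"
    by auto
  have "\<forall>t\<in>T. \<exists>W. open W \<and> x \<in> W \<and> (\<forall>z\<in>W. t z = z)"
    using T(2) by (auto simp: trivial_germs_def)
  then obtain W where W: "\<And>t. t \<in> T \<Longrightarrow> open (W t) \<and> x \<in> W t \<and> (\<forall>z\<in>W t. t z = z)"
    by metis
  have open_W: "open (\<Inter>t\<in>T. W t)" using T(1) W by (intro open_INT) auto
  have "T \<subseteq> H" using T(2) by (auto simp: trivial_germs_def)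
  then have "\<forall>p\<in>(\<Inter>t\<in>T. W t). k p = p"
    using dominatedD[OF k _ dom open_W] W by blast
  then show "k \<in> trivial_germs"
    unfolding trivial_germs_def using k open_W W by blast
qed

lemma trivial_germs_subset_support_ideal:
  assumes compact: "compact (UNIV :: 'a set)"
    and minimal: "\<And>p. p \<noteq> x \<Longrightarrow> \<exists>W. open W \<and> p \<in> W \<and> x \<notin> W \<and>
       (\<forall>V. open V \<longrightarrow> V \<inter> W \<noteq> {} \<longrightarrow> (\<exists>h\<in>H. h p \<in> V \<inter> W))"
    and I: "support_ideal (homeos H) I"
  shows "trivial_germs \<subseteq> I"
proof
  fix g assume "g \<in> trivial_germs"
  then obtain W where g: "g \<in> H" and W: "open W" "x \<in> W" "\<And>z. z \<in> W \<Longrightarrow> g z = z"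
    by (auto simp: trivial_germs_def)
  have IH: "I \<subseteq> H"
    and I_conj: "\<And>v h. v \<in> I \<Longrightarrow> h \<in> H \<Longrightarrow> inv_H h \<circ> v \<circ> h \<in> I"
    and I_centre: "\<And>f. f \<in> H \<Longrightarrow> (\<And>v. v \<in> I \<Longrightarrow> v \<circ> f = f \<circ> v) \<Longrightarrow> f = id"
    and I_dom: "\<And>T k. finite T \<Longrightarrow> T \<subseteq> I \<Longrightarrow> k \<in> H \<Longrightarrow> dominated (homeos H) k T \<Longrightarrow> k \<in> I"
    using I unfolding support_ideal_def by auto
  \<comment> \<open>The trivial centraliser yields \<open>v\<close> in \<open>I\<close> whose
    support meets \<open>U\<close>; some \<open>h\<close> carries \<open>p\<close> into that
    support, and conjugating \<open>v\<close> by \<open>h\<close> gives an element of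
    \<open>I\<close> moving \<open>p\<close>.\<close>
  have cover: "\<exists>t\<in>I. t p \<noteq> p" if px: "p \<noteq> x" for p
  proof -
    obtain U where U: "open U" "p \<in> U" "x \<notin> U"
      and orbit: "\<And>V. open V \<Longrightarrow> V \<inter> U \<noteq> {} \<Longrightarrow> \<exists>h\<in>H. h p \<in> V \<inter> U"
      using minimal[of p, OF px] by auto
    obtain f where f: "f \<in> Rist H U" "f p \<noteq> p" using moving U by blast
    then have fH: "f \<in> H" and "f \<noteq> id" using RistD by auto
    then obtain v where v: "v \<in> I" "v \<circ> f \<noteq> f \<circ> v" using I_centre by blast
    then have vH: "v \<in> H" using IH by blast
    obtain z where "v z \<noteq> z" "f z \<noteq> z"
      using disjoint_supports_commute[of v f] v(2) inj_H fH vH by blast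
    then have "{z. v z \<noteq> z} \<inter> U \<noteq> {}" using RistD(2)[OF f(1)] by blast
    then obtain h where h: "h \<in> H" "v (h p) \<noteq> h p"
      using orbit[OF open_support[OF vH]] by blast
    then have "(inv_H h \<circ> v \<circ> h) p \<noteq> p" by (metis comp_apply inv_simps(2))
    then show ?thesis using I_conj[OF v(1) h(1)] by blast
  qed
  \<comment> \<open>\<open>g\<close> is supported in \<open>- W\<close>, a compact set missing
    \<open>x\<close>, so \<open>cover\<close> applies to all its points.\<close>
  have K: "compact (- W)"
    using compact_Int_closed[OF compact closed_Compl[OF W(1)]] by simp
  have supp: "open {z. t z \<noteq> z}" if "t \<in> I" for t
    using open_support IH that by blast
  have K_sub: "- W \<subseteq> (\<Union>t\<in>I. {z. t z \<noteq> z})"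
  proof
    fix p assume "p \<in> - W"
    then have "p \<noteq> x" using W(2) by auto
    then show "p \<in> (\<Union>t\<in>I. {z. t z \<noteq> z})" using cover[of p] by simp
  qed
  obtain T where T: "T \<subseteq> I" "finite T" "- W \<subseteq> (\<Union>t\<in>T. {z. t z \<noteq> z})"
    using compactE_image[of "- W" I "\<lambda>t. {z. t z \<noteq> z}", OF K supp K_sub] .
  have "dominated (homeos H) g T"
  proof (rule dominatedI[OF g subset_trans[OF T(1) IH]])
    show "\<exists>t\<in>T. t z \<noteq> z" if "g z \<noteq> z" for z
    proof -
      have "z \<in> - W" using W(3)[of z] that by auto
      then show ?thesis using subsetD[OF T(3)] by auto
    qed
  qed
  then show "g \<in> I" by (rule I_dom[OF T(2,1) g])
qed

lemma least_support_ideal_eq_trivial_germs: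
  assumes "compact (UNIV :: 'a set)"
    and "\<And>p. p \<noteq> x \<Longrightarrow> \<exists>W. open W \<and> p \<in> W \<and> x \<notin> W \<and>
       (\<forall>V. open V \<longrightarrow> V \<inter> W \<noteq> {} \<longrightarrow> (\<exists>h\<in>H. h p \<in> V \<inter> W))"
  shows "least_support_ideal (homeos H) = trivial_germs"
proof
  show "least_support_ideal (homeos H) \<subseteq> trivial_germs"
    using support_ideal_trivial_germs unfolding least_support_ideal_def by blast
  have "g \<in> I" if "g \<in> trivial_germs" "support_ideal (homeos H) I" for g I
    using trivial_germs_subset_support_ideal[OF assms that(2)] that(1) ..
  moreover have "trivial_germs \<subseteq> H" unfolding trivial_germs_def by (rule Collect_restrict)
  ultimately show "trivial_germs \<subseteq> least_support_ideal (homeos H)"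
    unfolding least_support_ideal_def by auto
qed

end

section \<open>Stabilisers and groups of germs\<close>

lemma Rist_St: "x \<notin> U \<Longrightarrow> Rist (St G x) U = Rist G U"
  by (auto simp: Rist_def mem_St)

text \<open>Density is restated as hitting open sets, for the orbit of \<open>p\<close> itself. As
  \<open>U\<close> is open, open sets of the whole space replace relatively open ones.\<close>

lemma locally_minimal_orbit:
  assumes "locally_minimal_action (homeos H) (\<lambda>g. g) (top_of_set U)" "open U" "p \<in> U"
  obtains W where "open W" "p \<in> W" "W \<subseteq> U"
    "\<And>V. open V \<Longrightarrow> V \<inter> W \<noteq> {} \<Longrightarrow> \<exists>h\<in>H. h p \<in> V \<inter> W"
proof -
  obtain W where W: "openin (top_of_set U) W" "p \<in> W"
    and d: "Abstract_Topology.closure_of (subtopology (top_of_set U) W) (orbit (homeos H) (\<lambda>g. g) p \<inter> W) = W"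
    using assms(1,3) unfolding locally_minimal_action_def by fastforce
  have WU: "open W" "W \<subseteq> U" using W assms(2) by (auto simp: openin_open_eq)
  have "\<exists>h\<in>H. h p \<in> V \<inter> W" if V: "open V" "V \<inter> W \<noteq> {}" for V
  proof -
    obtain q where q: "q \<in> V" "q \<in> W" using V by blast
    have "q \<in> Abstract_Topology.closure_of (subtopology (top_of_set U) W) (orbit (homeos H) (\<lambda>g. g) p \<inter> W)"
      using q d by simp
    moreover have "openin (subtopology (top_of_set U) W) (V \<inter> W)"
      using V WU by (simp add: subtopology_subtopology openin_open) blast
    ultimately show ?thesis
      using q by (auto simp: in_closure_of orbit_def)
  qed
  then show thesis using that W WU by blast
qed

lemma St0_least_support_ideal:
  fixes G :: "('a::t2_space \<Rightarrow> 'a) set"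
  assumes compact: "compact (UNIV :: 'a set)" and G: "subgroup G homeo_group"
    and lm: "\<And>U :: 'a set. open U \<Longrightarrow>
           locally_minimal_action (homeos (Rist G U)) (\<lambda>g. g) (top_of_set U)"
    and no_isolated: "\<And>p :: 'a. \<not> open {p}"
  shows "St0 G x = least_support_ideal (homeos (St G x))"
proof -
  interpret locally_moving "St G x" x
  proof (rule locally_moving.intro)
    show "subgroup (St G x) homeo_group" by (rule subgroup_St[OF G])
    show "h x = x" if "h \<in> St G x" for h using that by (simp add: mem_St)
    show "\<exists>g\<in>Rist (St G x) U. g p \<noteq> p" if U: "open U" "x \<notin> U" "p \<in> U" for U p
    proof -
      obtain W where W: "open W" "p \<in> W" "W \<subseteq> U"
        and orbit: "\<And>V. open V \<Longrightarrow> V \<inter> W \<noteq> {} \<Longrightarrow> \<exists>h\<in>Rist G U. h p \<in> V \<inter> W"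
        using locally_minimal_orbit[OF lm[OF U(1)] U(1,3)] by metis
      \<comment> \<open>Without isolated points \<open>W\<close> has a second point, so an orbit
        dense in \<open>W\<close> cannot stay at \<open>p\<close>.\<close>
      have "W \<noteq> {p}" using W(1) no_isolated by metis
      then have "- {p} \<inter> W \<noteq> {}" using W(2) by blast
      then obtain g where "g \<in> Rist G U" "g p \<noteq> p"
        using orbit[of "- {p}"] by auto
      then show ?thesis using Rist_St[OF U(2)] by blast
    qed
  qed
  have "least_support_ideal (homeos (St G x)) = trivial_germs"
  proof (rule least_support_ideal_eq_trivial_germs[OF compact])
    fix p assume "p \<noteq> x"
    then have p: "p \<in> - {x}" by simp
    \<comment> \<open>\<open>Rist G (- {x})\<close> consists of the elements of \<open>G\<close>
      fixing \<open>x\<close>, so local minimality on this set is a statement about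
      \<open>St G x\<close>.\<close>
    have oU: "open (- {x})" by auto
    obtain W where W: "open W" "p \<in> W" "W \<subseteq> - {x}"
      and orbit: "\<And>V. open V \<Longrightarrow> V \<inter> W \<noteq> {} \<Longrightarrow> \<exists>h\<in>Rist G (- {x}). h p \<in> V \<inter> W"
      using locally_minimal_orbit[OF lm[OF oU] oU p] by metis
    have "Rist G (- {x}) \<subseteq> St G x" by (auto simp: Rist_def mem_St)
    then show "\<exists>W. open W \<and> p \<in> W \<and> x \<notin> W \<and>
       (\<forall>V. open V \<longrightarrow> V \<inter> W \<noteq> {} \<longrightarrow> (\<exists>h\<in>St G x. h p \<in> V \<inter> W))"
      using W orbit by (intro exI[of _ W]) blast
  qed
  moreover have "St0 G x = trivial_germs"
    unfolding trivial_germs_def St0_def by (simp add: subset_eq)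
  ultimately show ?thesis by simp
qed

text \<open>The dense orbit of \<open>q\<close> meets the open set \<open>{p}\<close>, and a
  homeomorphism taking \<open>q\<close> to \<open>p\<close> pulls \<open>{p}\<close> back to
  \<open>{q}\<close>.\<close>

lemma minimal_action_isolated:
  fixes G :: "('a::t2_space \<Rightarrow> 'a) set" and p q :: 'a
  assumes G: "subgroup G homeo_group"
    and minimal: "minimal_action (homeos G) (\<lambda>g. g) (euclidean :: 'a topology)"
    and p: "open {p}"
  shows "open {q}"
proof -
  have "Abstract_Topology.closure_of euclidean (orbit (homeos G) (\<lambda>g. g) q) = UNIV"
    using minimal unfolding minimal_action_def topspace_euclidean by (rule bspec) (rule UNIV_I)
  then have "closure (orbit (homeos G) (\<lambda>g. g) q) = UNIV"
    by (simp only: euclidean_closure_of)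
  then have "p \<in> orbit (homeos G) (\<lambda>g. g) q"
    using open_Int_closure_eq_empty[OF p, of "orbit (homeos G) (\<lambda>g. g) q"] by blast
  then obtain g where g: "g \<in> G" "g q = p" by (auto simp: orbit_def)
  have gc: "g \<in> carrier homeo_group" using g subgroup.subset[OF G] by blast
  then have "homeomorphic_map euclidean euclidean g" by (simp only: carrier_homeo_group)
  then have "continuous_on UNIV g"
    using homeomorphic_imp_continuous_map by fastforce
  then have "open (g -` {p})" using p by (simp add: open_vimage)
  moreover have "g -` {p} = {q}" 
  proof
    show "g -` {p} \<subseteq> {q}"
    proof
      fix z assume "z \<in> g -` {p}"
      then have "g z = g q" using g by simp
      then show "z \<in> {q}" using inv_homeo_group(1)[OF gc, of z] inv_homeo_group(1)[OF gc, of q]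
        by (metis singletonI)
    qed
  qed (use g in simp)
  ultimately show ?thesis by simp
qed
lemma St0_iso:
  fixes G :: "('a::t2_space \<Rightarrow> 'a) set" and x y :: 'a
  assumes "compact (UNIV :: 'a set)" and G: "subgroup G homeo_group"
    and "minimal_action (homeos G) (\<lambda>g. g) (euclidean :: 'a topology)"
    and "\<And>U :: 'a set. open U \<Longrightarrow>
           locally_minimal_action (homeos (Rist G U)) (\<lambda>g. g) (top_of_set U)"
    and \<phi>: "\<phi> \<in> iso (homeos (St G x)) (homeos (St G y))"
  shows "\<phi> ` St0 G x = St0 G y"
proof (cases "\<exists>p :: 'a. open {p}")
  case True
  then have "open {p}" for p :: 'a using minimal_action_isolated[OF assms(2,3)] by blast
  \<comment> \<open>The neighbourhood \<open>{p}\<close> makes \<open>St0\<close> all of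
    \<open>St\<close>, so the claim is just surjectivity of \<open>\<phi>\<close>.\<close>
  then have "\<exists>W. open W \<and> p \<in> W \<and> W \<subseteq> {z. g z = z}" if "g \<in> St G p" for g p
    using that by (intro exI[of _ "{p}"]) (simp add: mem_St)
  then have "St0 G p = St G p" for p unfolding St0_def by blast
  then show ?thesis using \<phi> by (simp add: iso_def bij_betw_def)
next
  case False
  have "group (homeos (St G p))" for p
    using group.subgroup_imp_group[OF group_homeo_group subgroup_St[OF G]] .
  then show ?thesis
    using least_support_ideal_iso[OF _ _ \<phi>] St0_least_support_ideal[OF assms(1,2,4)] False by simp
qed

theorem corollary2p7:
  fixes G :: "('a::t2_space \<Rightarrow> 'a) set" and x y :: 'a
  assumes "compact (UNIV :: 'a set)"
    and "subgroup G homeo_group"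
    and "minimal_action (homeos G) (\<lambda>g. g) (euclidean :: 'a topology)"
    and "\<And>U :: 'a set. open U \<Longrightarrow>
           locally_minimal_action (homeos (Rist G U)) (\<lambda>g. g) (top_of_set U)"
  shows "(\<not> germ_group G x \<cong> germ_group G y \<longrightarrow>
            \<not> homeos (St G x) \<cong> homeos (St G y)) \<and>
         (regular_point G x \<and> singular_point G y \<longrightarrow>
            \<not> homeos (St G x) \<cong> homeos (St G y))"
proof -
  \<comment> \<open>Both halves are contrapositives of this. For the second, \<open>\<phi>\<close>
    takes \<open>St\<close> onto \<open>St\<close> and \<open>St0\<close> onto \<open>St0\<close>,
    so their equality at \<open>x\<close> passes to \<open>y\<close>.\<close>
  have "germ_group G x \<cong> germ_group G y \<and> (regular_point G x \<longrightarrow> regular_point G y)"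
    if iso: "homeos (St G x) \<cong> homeos (St G y)"
  proof -
    obtain \<phi> where \<phi>: "\<phi> \<in> iso (homeos (St G x)) (homeos (St G y))"
      using iso unfolding is_iso_def by blast
    have im: "\<phi> ` St0 G x = St0 G y" using St0_iso[OF assms \<phi>] .
    have grp: "group (homeos (St G p))" for p
      using group.subgroup_imp_group[OF group_homeo_group subgroup_St[OF assms(2)]] .
    have "germ_group G x \<cong> germ_group G y"
      unfolding germ_group_def
      using FactGroup_iso_cong[OF grp grp \<phi> normal_St0[OF assms(2)] normal_St0[OF assms(2)] im] .
    moreover have "\<phi> ` St G x = St G y" using \<phi> by (simp add: iso_def bij_betw_def)
    ultimately show ?thesis using im by (auto simp: regular_point_def)
  qed
  then show ?thesis by (auto simp: singular_point_def)
qed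

end
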